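(* Let $(Z,\mathfrak{I},E)$ be a soft topological space. Then $\mathfrak{I}$ is maximal soft compact if and only if the family of all soft $\mathfrak{I}$-closed sets is equal to the family of all soft $\mathfrak{I}$-compact sets.
   Context: A soft set over $Z$ with parameter set $E$ is a pair $(Y,E)$ where $Y:E\to\mathcal{P}(Z)$ is a map. Inclusion, unions, intersections and complements of soft sets are taken parameterwise (e.g. $Y^c(e)=Z\setminus Y(e)$). The null soft set $\widetilde{\Phi}$ is $\emptyset$ at every $e$; the absolute soft set $\widetilde{Z}$ is $Z$ at every $e$. A soft topology on $Z$ is a collection $\mathfrak{I}$ of soft sets over $Z$ containing $\widetilde{\Phi},\widetilde{Z}$, closed under intersections of two members and under arbitrary unions; $(Z,\mathfrak{I},E)$ is then a soft topological space. Members of $\mathfrak{I}$ are soft ($\mathfrak{I}$-)open and their complements are soft ($\mathfrak{I}$-)closed. A soft set $(Y,E)$ is soft ($\mathfrak{I}$-)compact if every family of soft open sets whose union contains $(Y,E)$ has a finite subfamily whose union contains $(Y,E)$; the space is soft compact if $\widetilde{Z}$ is soft compact. $\mathfrak{I}$ is maximal soft compact if $(Z,\mathfrak{I},E)$ is soft compact and no soft topology on $Z$ (with the same parameter set $E$) strictly finer than $\mathfrak{I}$ (i.e. strictly containing it) is soft compact. *)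

theory Defs
  imports Main "HOL-Library.FuncSet"
begin

text \<open>
  Soft sets over \<open>Z\<close> with parameter set \<open>E\<close> are the maps from \<open>E\<close> to \<open>Pow Z\<close>, taken to be
  extensional (undefined outside \<open>E\<close>), so that HOL equality of two of them is equality on \<open>E\<close>.
  Neither \<open>Z\<close> nor \<open>E\<close> is required to be nonempty.
\<close>

definition soft_sets :: "'z set \<Rightarrow> 'e set \<Rightarrow> ('e \<Rightarrow> 'z set) set" where
  "soft_sets Z E = E \<rightarrow>\<^sub>E Pow Z"

definition soft_subset :: "'e set \<Rightarrow> ('e \<Rightarrow> 'z set) \<Rightarrow> ('e \<Rightarrow> 'z set) \<Rightarrow> bool" where
  "soft_subset E Y W \<longleftrightarrow> (\<forall>e\<in>E. Y e \<subseteq> W e)"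

definition soft_Union :: "'e set \<Rightarrow> ('e \<Rightarrow> 'z set) set \<Rightarrow> 'e \<Rightarrow> 'z set" where
  "soft_Union E F = (\<lambda>e\<in>E. \<Union>Y\<in>F. Y e)"

definition soft_inter :: "'e set \<Rightarrow> ('e \<Rightarrow> 'z set) \<Rightarrow> ('e \<Rightarrow> 'z set) \<Rightarrow> 'e \<Rightarrow> 'z set" where
  "soft_inter E Y W = (\<lambda>e\<in>E. Y e \<inter> W e)"

definition soft_complement :: "'z set \<Rightarrow> 'e set \<Rightarrow> ('e \<Rightarrow> 'z set) \<Rightarrow> 'e \<Rightarrow> 'z set" where
  "soft_complement Z E Y = (\<lambda>e\<in>E. Z - Y e)"

definition soft_null :: "'e set \<Rightarrow> 'e \<Rightarrow> 'z set" where
  "soft_null E = (\<lambda>e\<in>E. {})"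

definition soft_absolute :: "'z set \<Rightarrow> 'e set \<Rightarrow> 'e \<Rightarrow> 'z set" where
  "soft_absolute Z E = (\<lambda>e\<in>E. Z)"

definition soft_topology :: "'z set \<Rightarrow> 'e set \<Rightarrow> ('e \<Rightarrow> 'z set) set \<Rightarrow> bool" where
  "soft_topology Z E T \<longleftrightarrow>
     T \<subseteq> soft_sets Z E \<and>
     soft_null E \<in> T \<and>
     soft_absolute Z E \<in> T \<and>
     (\<forall>U\<in>T. \<forall>V\<in>T. soft_inter E U V \<in> T) \<and>
     (\<forall>F. F \<subseteq> T \<longrightarrow> soft_Union E F \<in> T)"

definition soft_closed :: "'z set \<Rightarrow> 'e set \<Rightarrow> ('e \<Rightarrow> 'z set) set \<Rightarrow> ('e \<Rightarrow> 'z set) \<Rightarrow> bool" where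
  "soft_closed Z E T Y \<longleftrightarrow> (\<exists>U\<in>T. Y = soft_complement Z E U)"

definition soft_compact :: "'z set \<Rightarrow> 'e set \<Rightarrow> ('e \<Rightarrow> 'z set) set \<Rightarrow> ('e \<Rightarrow> 'z set) \<Rightarrow> bool" where
  "soft_compact Z E T Y \<longleftrightarrow>
     Y \<in> soft_sets Z E \<and>
     (\<forall>F. F \<subseteq> T \<and> soft_subset E Y (soft_Union E F) \<longrightarrow>
       (\<exists>G. G \<subseteq> F \<and> finite G \<and> soft_subset E Y (soft_Union E G)))"

definition soft_compact_space :: "'z set \<Rightarrow> 'e set \<Rightarrow> ('e \<Rightarrow> 'z set) set \<Rightarrow> bool" where
  "soft_compact_space Z E T \<longleftrightarrow> soft_compact Z E T (soft_absolute Z E)"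

definition maximal_soft_compact :: "'z set \<Rightarrow> 'e set \<Rightarrow> ('e \<Rightarrow> 'z set) set \<Rightarrow> bool" where
  "maximal_soft_compact Z E T \<longleftrightarrow>
     soft_compact_space Z E T \<and>
     \<not> (\<exists>T'. soft_topology Z E T' \<and> T \<subset> T' \<and> soft_compact_space Z E T')"

end

theory Submission
  imports Defs
begin

text \<open>
  A soft set \<open>Y\<close> is the same thing as the subset \<open>Sigma E Y\<close> of \<open>E \<times> Z\<close>, and under this
  correspondence a soft topology is an ordinary topology on \<open>E \<times> Z\<close>; the theorem is the soft form
  of the characterisation of maximal compact topologies as those whose compact sets are exactly the
  closed ones.

  If the closed and the compact soft sets agree, then the absolute soft set, being closed, is
  compact. In a finer compact topology \<open>T'\<close>, the complement of an open set is \<open>T'\<close>-compact, hence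
  compact in the coarser \<open>T\<close>, hence \<open>T\<close>-closed; so \<open>T'\<close> adds no open set.

  Conversely, let \<open>T\<close> be maximal. Closed sets are compact because the space is. If some compact
  \<open>K\<close> were not closed, adjoining its complement \<open>V\<close> to \<open>T\<close> would give a strictly finer topology,
  and this topology is still compact (lemma \<open>compact_space_adjoin_complement\<close>): the part of a
  new open set that meets \<open>K\<close> comes from an old open set, and off \<open>K\<close> the restriction to \<open>V\<close> costs
  nothing. That contradicts maximality.
\<close>

lemma soft_sets_mem: "Y \<in> soft_sets Z E \<Longrightarrow> e \<in> E \<Longrightarrow> z \<in> Y e \<Longrightarrow> z \<in> Z"
  by (auto simp: soft_sets_def)

lemma restrict_in_soft_sets:
  "(\<And>e. e \<in> E \<Longrightarrow> f e \<subseteq> Z) \<Longrightarrow> (\<lambda>e\<in>E. f e) \<in> soft_sets Z E"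
  by (auto simp: soft_sets_def)

lemma soft_eq_restrict:
  assumes "Y \<in> soft_sets Z E" "\<And>e. e \<in> E \<Longrightarrow> Y e = f e"
  shows "Y = (\<lambda>e\<in>E. f e)"
  using assms by (auto simp: soft_sets_def PiE_def extensional_def fun_eq_iff)

lemma soft_complement_complement:
  assumes "Y \<in> soft_sets Z E"
  shows "soft_complement Z E (soft_complement Z E Y) = Y"
  using soft_sets_mem[OF assms]
  by (subst soft_eq_restrict[OF assms, of "\<lambda>e. Z - (Z - Y e)"])
     (auto simp: soft_complement_def fun_eq_iff)

lemma soft_subset_Union_iff:
  "soft_subset E Y (soft_Union E F) \<longleftrightarrow> (\<forall>e\<in>E. \<forall>z\<in>Y e. \<exists>W\<in>F. z \<in> W e)"
  by (auto simp: soft_subset_def soft_Union_def)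

lemma soft_compact_coarser:
  assumes "soft_compact Z E T' Y" "T \<subseteq> T'"
  shows "soft_compact Z E T Y"
  using assms by (auto simp: soft_compact_def)

text \<open>
  An open cover of a closed set becomes a cover of the space once the open complement is added; that
  complement contributes no point of the closed set and may be dropped again from a finite subcover.
\<close>

lemma soft_closed_imp_compact:
  assumes comp: "soft_compact_space Z E T" and closed: "soft_closed Z E T C"
  shows "soft_compact Z E T C"
proof -
  obtain U where U: "U \<in> T" and C: "C = soft_complement Z E U"
    using closed by (auto simp: soft_closed_def)
  have "\<exists>G. G \<subseteq> F \<and> finite G \<and> soft_subset E C (soft_Union E G)"
    if F: "F \<subseteq> T" "soft_subset E C (soft_Union E F)" for F
  proof -
    have "insert U F \<subseteq> T" "soft_subset E (soft_absolute Z E) (soft_Union E (insert U F))"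
      using F U by (auto simp: soft_subset_Union_iff C soft_complement_def soft_absolute_def)
    then obtain G where G: "G \<subseteq> insert U F" "finite G"
        "soft_subset E (soft_absolute Z E) (soft_Union E G)"
      using comp unfolding soft_compact_space_def soft_compact_def by meson
    have "soft_subset E C (soft_Union E (G - {U}))"
      using G(3) by (fastforce simp: soft_subset_Union_iff C soft_complement_def soft_absolute_def)
    then show ?thesis
      using G(1,2) by (intro exI[of _ "G - {U}"]) auto
  qed
  then show ?thesis
    unfolding soft_compact_def C soft_complement_def by (simp add: restrict_in_soft_sets)
qed

text \<open>
  The topology generated by \<open>T\<close> and one further set \<open>V\<close>. Its members have the form
  \<open>U \<union> (W \<inter> V)\<close> with \<open>U, W \<in> T\<close>. Replacing \<open>W\<close> by \<open>U \<union> W\<close> one may take \<open>U\<close> inside \<open>W\<close>; such a set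
  agrees with \<open>W\<close> on \<open>V\<close> and with \<open>U\<close> off \<open>V\<close>, so intersections and unions of these sets are formed
  separately in the two components.
\<close>

definition adjoin_open :: "'e set \<Rightarrow> ('e \<Rightarrow> 'z set) set \<Rightarrow> ('e \<Rightarrow> 'z set) \<Rightarrow> ('e \<Rightarrow> 'z set) set" where
  "adjoin_open E T V =
     {Y. \<exists>U\<in>T. \<exists>W\<in>T. soft_subset E U W \<and> Y = (\<lambda>e\<in>E. U e \<union> (W e \<inter> V e))}"

lemma adjoin_openI:
  assumes "U \<in> T" "W \<in> T" "soft_subset E U W" "Y = (\<lambda>e\<in>E. U e \<union> (W e \<inter> V e))"
  shows "Y \<in> adjoin_open E T V"
  using assms by (auto simp: adjoin_open_def)

lemma subset_adjoin_open:
  assumes "soft_topology Z E T"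
  shows "T \<subseteq> adjoin_open E T V"
proof
  fix U assume U: "U \<in> T"
  then have "U \<in> soft_sets Z E"
    using assms by (auto simp: soft_topology_def)
  then show "U \<in> adjoin_open E T V"
    by (intro adjoin_openI[OF U U]) (auto simp: soft_subset_def intro: soft_eq_restrict)
qed

lemma mem_adjoin_open:
  assumes top: "soft_topology Z E T" and V: "V \<in> soft_sets Z E"
  shows "V \<in> adjoin_open E T V"
proof (rule adjoin_openI)
  show "soft_null E \<in> T" "soft_absolute Z E \<in> T"
    using top by (auto simp: soft_topology_def)
  show "soft_subset E (soft_null E) (soft_absolute Z E)"
    by (simp add: soft_subset_def soft_null_def)
  show "V = (\<lambda>e\<in>E. soft_null E e \<union> (soft_absolute Z E e \<inter> V e))"
    using soft_sets_mem[OF V]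
    by (intro soft_eq_restrict[OF V]) (auto simp: soft_null_def soft_absolute_def)
qed

lemma soft_topology_adjoin_open:
  assumes top: "soft_topology Z E T"
  shows "soft_topology Z E (adjoin_open E T V)"
proof -
  have inter: "soft_inter E U W \<in> T" if "U \<in> T" "W \<in> T" for U W
    using top that by (auto simp: soft_topology_def)
  have union: "soft_Union E F \<in> T" if "F \<subseteq> T" for F
    using top that by (auto simp: soft_topology_def)
  have T_soft: "T \<subseteq> soft_sets Z E"
    using top by (auto simp: soft_topology_def)
  show ?thesis
    unfolding soft_topology_def
  proof (intro conjI ballI allI impI)
    show "adjoin_open E T V \<subseteq> soft_sets Z E"
    proof
      fix Y assume "Y \<in> adjoin_open E T V"
      then obtain U W where "U \<in> T" "W \<in> T" and Y: "Y = (\<lambda>e\<in>E. U e \<union> (W e \<inter> V e))"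
        by (auto simp: adjoin_open_def)
      then have "U \<in> soft_sets Z E" "W \<in> soft_sets Z E"
        using T_soft by auto
      then show "Y \<in> soft_sets Z E"
        unfolding Y by (intro restrict_in_soft_sets) (auto dest: soft_sets_mem)
    qed
    show "soft_null E \<in> adjoin_open E T V" "soft_absolute Z E \<in> adjoin_open E T V"
      using subset_adjoin_open[OF top] top by (auto simp: soft_topology_def)
  next
    fix Y Y' assume "Y \<in> adjoin_open E T V" "Y' \<in> adjoin_open E T V"
    then obtain U W U' W' where
      *: "U \<in> T" "W \<in> T" "soft_subset E U W" "Y = (\<lambda>e\<in>E. U e \<union> (W e \<inter> V e))"
         "U' \<in> T" "W' \<in> T" "soft_subset E U' W'" "Y' = (\<lambda>e\<in>E. U' e \<union> (W' e \<inter> V e))"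
      by (auto simp: adjoin_open_def)
    show "soft_inter E Y Y' \<in> adjoin_open E T V"
    proof (rule adjoin_openI)
      show "soft_inter E U U' \<in> T" "soft_inter E W W' \<in> T"
        using * inter by auto
      show "soft_subset E (soft_inter E U U') (soft_inter E W W')"
        using * by (auto simp: soft_subset_def soft_inter_def)
      show "soft_inter E Y Y' = (\<lambda>e\<in>E. soft_inter E U U' e \<union> (soft_inter E W W' e \<inter> V e))"
        using *(3,7) unfolding *(4,8) soft_inter_def
        by (intro restrict_ext) (auto simp: soft_subset_def)
    qed
  next
    fix F assume F: "F \<subseteq> adjoin_open E T V"
    \<comment> \<open>Taking all representations of all members of \<open>F\<close> avoids choosing one for each.\<close>
    define rep where "rep U W \<longleftrightarrow> U \<in> T \<and> W \<in> T \<and> soft_subset E U W \<and>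
      (\<lambda>e\<in>E. U e \<union> (W e \<inter> V e)) \<in> F" for U W
    define A where "A = {U. \<exists>W. rep U W}"
    define B where "B = {W. \<exists>U. rep U W}"
    show "soft_Union E F \<in> adjoin_open E T V"
    proof (rule adjoin_openI)
      show "soft_Union E A \<in> T" "soft_Union E B \<in> T"
        by (auto intro!: union simp: A_def B_def rep_def)
      show "soft_subset E (soft_Union E A) (soft_Union E B)"
        unfolding soft_subset_def soft_Union_def A_def B_def
        by (auto simp: rep_def soft_subset_def) blast
      have "(\<Union>Y\<in>F. Y e) = (\<Union>U\<in>A. U e) \<union> ((\<Union>W\<in>B. W e) \<inter> V e)" if e: "e \<in> E" for e
      proof (intro equalityI subsetI)
        fix z assume "z \<in> (\<Union>Y\<in>F. Y e)"
        then obtain Y where Y: "Y \<in> F" "z \<in> Y e" by blast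
        then obtain U W where "rep U W" "Y = (\<lambda>e\<in>E. U e \<union> (W e \<inter> V e))"
          using F by (auto simp: adjoin_open_def rep_def)
        then show "z \<in> (\<Union>U\<in>A. U e) \<union> ((\<Union>W\<in>B. W e) \<inter> V e)"
          using Y(2) e by (auto simp: A_def B_def)
      next
        fix z assume "z \<in> (\<Union>U\<in>A. U e) \<union> ((\<Union>W\<in>B. W e) \<inter> V e)"
        then obtain U W where UW: "rep U W" "z \<in> U e \<union> (W e \<inter> V e)"
          by (auto simp: A_def B_def)
        then show "z \<in> (\<Union>Y\<in>F. Y e)"
          using e by (intro UN_I[of "\<lambda>e\<in>E. U e \<union> (W e \<inter> V e)"]) (auto simp: rep_def)
      qed
      then show "soft_Union E F = (\<lambda>e\<in>E. soft_Union E A e \<union> (soft_Union E B e \<inter> V e))"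
        unfolding soft_Union_def by (intro restrict_ext) simp
    qed
  qed
qed

text \<open>
  Given a cover \<open>F\<close> of the space by sets \<open>U \<union> (W \<inter> V)\<close>, the \<open>T\<close>-open parts \<open>U\<close> must already cover
  \<open>K\<close>, which misses \<open>V\<close>; finitely many do. These, together with the sets \<open>W\<close>, are a \<open>T\<close>-open cover
  of the whole space, and again finitely many suffice. A point missed by the chosen \<open>U\<close> lies
  outside \<open>K\<close>, that is in \<open>V\<close>, so the \<open>W\<close> that contains it may be cut down to \<open>W \<inter> V\<close>.
\<close>

lemma compact_space_adjoin_complement:
  assumes comp: "soft_compact_space Z E T" and K: "soft_compact Z E T K"
  defines "V \<equiv> soft_complement Z E K"
  shows "soft_compact_space Z E (adjoin_open E T V)"
proof -
  have V: "z \<in> V e \<longleftrightarrow> z \<in> Z \<and> z \<notin> K e" if "e \<in> E" for e z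
    using that by (simp add: V_def soft_complement_def)
  have K_soft: "K \<in> soft_sets Z E"
    using K by (simp add: soft_compact_def)
  have "\<exists>G. G \<subseteq> F \<and> finite G \<and> soft_subset E (soft_absolute Z E) (soft_Union E G)"
    if F: "F \<subseteq> adjoin_open E T V" and cover: "soft_subset E (soft_absolute Z E) (soft_Union E F)"
    for F
  proof -
    have ex: "\<exists>Y\<in>F. z \<in> Y e" if "e \<in> E" "z \<in> Z" for e z
      using cover that by (auto simp: soft_subset_Union_iff soft_absolute_def)
    \<comment> \<open>All open sets that can serve as a \<open>U\<close> or a \<open>W\<close>: only their lying inside a member of \<open>F\<close> is
      kept, so that finite subcovers by them turn back into finite subfamilies of \<open>F\<close>.\<close>
    define A where "A = {U\<in>T. \<exists>Y\<in>F. \<forall>e\<in>E. U e \<subseteq> Y e}"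
    define B where "B = {W\<in>T. \<exists>Y\<in>F. \<forall>e\<in>E. W e \<inter> V e \<subseteq> Y e}"
    have AB: "(\<exists>U\<in>A. z \<in> U e) \<or> (z \<in> V e \<and> (\<exists>W\<in>B. z \<in> W e))" if e: "e \<in> E" and z: "z \<in> Z" for e z
    proof -
      obtain Y where Y: "Y \<in> F" "z \<in> Y e"
        using ex[OF e z] by blast
      then obtain U W where UW: "U \<in> T" "W \<in> T" "Y = (\<lambda>e\<in>E. U e \<union> (W e \<inter> V e))"
        using F by (auto simp: adjoin_open_def)
      have "U \<in> A"
        using UW Y(1) by (auto simp: A_def intro!: bexI[of _ Y])
      moreover have "W \<in> B"
        using UW Y(1) by (auto simp: B_def intro!: bexI[of _ Y])
      ultimately show ?thesis
        using Y(2) e by (auto simp: UW(3))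
    qed
    have "soft_subset E K (soft_Union E A)"
      unfolding soft_subset_Union_iff using AB soft_sets_mem[OF K_soft] V by blast
    moreover have "A \<subseteq> T"
      by (auto simp: A_def)
    ultimately obtain GA where GA: "GA \<subseteq> A" "finite GA" "soft_subset E K (soft_Union E GA)"
      using K unfolding soft_compact_def by meson
    have "soft_subset E (soft_absolute Z E) (soft_Union E (GA \<union> B))"
      unfolding soft_subset_Union_iff
    proof (intro ballI)
      fix e z assume e: "e \<in> E" and "z \<in> soft_absolute Z E e"
      then have z: "z \<in> Z" by (simp add: soft_absolute_def)
      have "\<exists>U\<in>A. z \<in> U e \<Longrightarrow> \<exists>W\<in>B. z \<in> W e"
        unfolding A_def B_def using e by blast
      then show "\<exists>W\<in>GA \<union> B. z \<in> W e"
        using AB[OF e z] by blast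
    qed
    moreover have "GA \<union> B \<subseteq> T"
      using GA(1) by (auto simp: A_def B_def)
    ultimately obtain G where G: "G \<subseteq> GA \<union> B" "finite G"
        "soft_subset E (soft_absolute Z E) (soft_Union E G)"
      using comp unfolding soft_compact_space_def soft_compact_def by meson
    obtain f where f: "\<And>U. U \<in> A \<Longrightarrow> f U \<in> F \<and> (\<forall>e\<in>E. U e \<subseteq> f U e)"
      using bchoice[of A "\<lambda>U Y. Y \<in> F \<and> (\<forall>e\<in>E. U e \<subseteq> Y e)"] by (auto simp: A_def)
    obtain g where g: "\<And>W. W \<in> B \<Longrightarrow> g W \<in> F \<and> (\<forall>e\<in>E. W e \<inter> V e \<subseteq> g W e)"
      using bchoice[of B "\<lambda>W Y. Y \<in> F \<and> (\<forall>e\<in>E. W e \<inter> V e \<subseteq> Y e)"] by (auto simp: B_def)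
    let ?H = "f ` GA \<union> g ` (G \<inter> B)"
    have "soft_subset E (soft_absolute Z E) (soft_Union E ?H)"
      unfolding soft_subset_Union_iff
    proof (intro ballI)
      fix e z assume e: "e \<in> E" and z: "z \<in> soft_absolute Z E e"
      show "\<exists>Y\<in>?H. z \<in> Y e"
      proof (cases "\<exists>U\<in>GA. z \<in> U e")
        case True
        then show ?thesis using f GA(1) e by blast
      next
        case False
        then have "z \<notin> K e"
          using GA(3) e unfolding soft_subset_Union_iff by blast
        then have "z \<in> V e"
          using V[OF e] e z by (simp add: soft_absolute_def)
        moreover obtain W where "W \<in> G \<inter> B" "z \<in> W e"
          using G(1,3) e z False unfolding soft_subset_Union_iff by blast
        ultimately show ?thesis using g e by blast
      qed
    qed
    moreover have "?H \<subseteq> F" "finite ?H"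
      using f g GA G by auto
    ultimately show ?thesis by blast
  qed
  then show ?thesis
    using comp unfolding soft_compact_space_def soft_compact_def by blast
qed

theorem proposition3p14:
  fixes Z :: "'z set" and E :: "'e set" and T :: "('e \<Rightarrow> 'z set) set"
  assumes "soft_topology Z E T"
  shows "maximal_soft_compact Z E T \<longleftrightarrow>
    {Y. soft_closed Z E T Y} = {Y. soft_compact Z E T Y}"
proof
  assume max: "maximal_soft_compact Z E T"
  then have comp: "soft_compact_space Z E T"
    by (simp add: maximal_soft_compact_def)
  have "soft_closed Z E T K" if K: "soft_compact Z E T K" for K
  proof -
    let ?V = "soft_complement Z E K"
    let ?T' = "adjoin_open E T ?V"
    have K_soft: "K \<in> soft_sets Z E"
      using K by (simp add: soft_compact_def)
    have "\<not> T \<subset> ?T'"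
      using max soft_topology_adjoin_open[OF assms] compact_space_adjoin_complement[OF comp K]
      unfolding maximal_soft_compact_def by blast
    then have "T = ?T'"
      using subset_adjoin_open[OF assms] by blast
    moreover have "?V \<in> ?T'"
      by (rule mem_adjoin_open[OF assms])
         (auto simp: soft_complement_def intro: restrict_in_soft_sets)
    ultimately have "?V \<in> T" by simp
    then show ?thesis
      unfolding soft_closed_def using soft_complement_complement[OF K_soft] by metis
  qed
  then show "{Y. soft_closed Z E T Y} = {Y. soft_compact Z E T Y}"
    using soft_closed_imp_compact[OF comp] by blast
next
  assume "{Y. soft_closed Z E T Y} = {Y. soft_compact Z E T Y}"
  then have eq: "soft_closed Z E T Y \<longleftrightarrow> soft_compact Z E T Y" for Y
    by blast
  have "soft_null E \<in> T" "soft_absolute Z E = soft_complement Z E (soft_null E)"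
    using assms
    by (auto simp: soft_topology_def soft_absolute_def soft_complement_def soft_null_def fun_eq_iff)
  then have "soft_closed Z E T (soft_absolute Z E)"
    unfolding soft_closed_def by blast
  then have "soft_compact_space Z E T"
    by (simp add: eq soft_compact_space_def)
  moreover have "T' \<subseteq> T"
    if top': "soft_topology Z E T'" and "T \<subset> T'" and comp': "soft_compact_space Z E T'" for T'
  proof
    fix U assume U: "U \<in> T'"
    then have "soft_compact Z E T' (soft_complement Z E U)"
      by (intro soft_closed_imp_compact[OF comp']) (auto simp: soft_closed_def)
    then have "soft_compact Z E T (soft_complement Z E U)"
      by (rule soft_compact_coarser) (use \<open>T \<subset> T'\<close> in auto)
    then obtain W where W: "W \<in> T" "soft_complement Z E U = soft_complement Z E W"
      unfolding eq[symmetric] soft_closed_def by blast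
    have "U \<in> soft_sets Z E" "W \<in> soft_sets Z E"
      using U W(1) top' assms by (auto simp: soft_topology_def)
    then have "U = W"
      using W(2) soft_complement_complement by metis
    then show "U \<in> T"
      using W(1) by simp
  qed
  ultimately show "maximal_soft_compact Z E T"
    unfolding maximal_soft_compact_def by blast
qed

end
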